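(* Let $\theta(k,\varepsilon,n)>0$ (for integers $k\geq 2$, $n\geq 1$ and reals $0<\varepsilon\leq 1$) and integers $\mathrm{Cor}(k,\varepsilon,m)$ (for integers $k\geq 2$, $m\geq 1$ and reals $0<\varepsilon\leq1$) be constants with the following property (P): for every Carlson--Simpson tree $T$ of $[k]^{<\mathbb{N}}$ of dimension at least $\mathrm{Cor}(k,\varepsilon,m)$ and every family $\{A_t:t\in T\}$ of measurable events in a probability space $(\Omega,\Sigma,\mu)$ with $\mu(A_t)\geq\varepsilon$ for every $t\in T$, there exists a Carlson--Simpson tree $S\subseteq T$ of dimension $m$ such that $\mu\big(\bigcap_{t\in F}A_t\big)\geq\theta(k,\varepsilon,|F|)$ for every nonempty $F\subseteq S$. Let $k,m\in\mathbb{N}$ with $k\geq2$ and $m\geq1$, and let $0<\varepsilon\leq1$. If $N$ is a positive integer with $N\geq\mathrm{Cor}(k,\varepsilon,m)$ and $\{A_w:w\in[k]^N\}$ is a family of measurable events in a probability space $(\Omega,\Sigma,\mu)$ satisfying $\mu(A_w)\geq\varepsilon$ for every $w\in[k]^N$, then there exists an $m$-dimensional combinatorial subspace $V$ of $[k]^N$ such that for every $n\in\{1,\dots,|V|\}$ and every subset $F$ of $V$ of cardinality $n$ we have \[ \mu\Big(\bigcap_{w\in F}A_w\Big)\geq\theta(k,\varepsilon,n). \]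
   Context: Constants with property (P) exist (this is another theorem of the same paper). $\mathbb{N}=\{0,1,2,\dots\}$ and $[k]=\{1,\dots,k\}$. A word over $k$ is a finite (possibly empty) sequence with values in $[k]$; $[k]^N$ is the set of words of length $N$ and $[k]^{<\mathbb{N}}$ is the set of all words over $k$. Concatenation is denoted $u\circ v$. Fix a letter $x\notin[k]$, viewed as a variable. A left variable word over $k$ is a finite nonempty sequence with values in $[k]\cup\{x\}$ whose first letter is $x$; $w(a)$ denotes the word obtained by replacing every occurrence of $x$ in $w$ by $a\in[k]$. A Carlson--Simpson tree of $[k]^{<\mathbb{N}}$ of dimension $m\geq1$ is a set of the form \[ \{w\}\cup\big\{w\circ w_0(a_0)\circ\cdots\circ w_n(a_n): n\in\{0,\dots,m-1\},\ a_0,\dots,a_n\in[k]\big\} \] where $w$ is a word over $k$ and $w_0,\dots,w_{m-1}$ are left variable words over $k$ (these data are uniquely determined by the tree). An $m$-variable word over $k$ is a finite sequence with values in $[k]\cup\{x_0,\dots,x_{m-1}\}$ (with $x_0,\dots,x_{m-1}$ distinct letters not in $[k]$) in which every $x_i$ appears at least once and, for $i<j$, all occurrences of $x_i$ precede all occurrences of $x_j$. For such a $w$ and $a_0,\dots,a_{m-1}\in[k]$, $w(a_0,\dots,a_{m-1})$ is the word obtained by substituting $a_i$ for all occurrences of $x_i$, for every $i$. An $m$-dimensional combinatorial subspace of $[k]^N$ is a set of the form $\{w(a_0,\dots,a_{m-1}):a_0,\dots,a_{m-1}\in[k]\}$ where $w$ is an $m$-variable word over $k$ of length $N$. *)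

theory Defs
  imports "HOL-Probability.Probability"
begin

definition words :: "nat \<Rightarrow> nat list set" where
  "words k = {u. set u \<subseteq> {1..k}}"

definition words_of_length :: "nat \<Rightarrow> nat \<Rightarrow> nat list set" where
  "words_of_length k N = {u \<in> words k. length u = N}"

(* In words with one variable, None stands for the variable x and Some a for the letter a. *)

definition left_variable_word :: "nat \<Rightarrow> nat option list \<Rightarrow> bool" where
  "left_variable_word k w \<longleftrightarrow>
     w \<noteq> [] \<and> hd w = None \<and> set w \<subseteq> {None} \<union> Some ` {1..k}"

definition subst_x :: "nat option list \<Rightarrow> nat \<Rightarrow> nat list" where
  "subst_x w a = map (\<lambda>c. case c of None \<Rightarrow> a | Some b \<Rightarrow> b) w"

definition carlson_simpson_tree :: "nat \<Rightarrow> nat \<Rightarrow> nat list set \<Rightarrow> bool" where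
  "carlson_simpson_tree k m T \<longleftrightarrow> m \<ge> 1 \<and>
     (\<exists>w W. w \<in> words k \<and> (\<forall>i<m. left_variable_word k (W i)) \<and>
        T = {w} \<union> {w @ concat (map (\<lambda>i. subst_x (W i) (a i)) [0..<Suc n]) | n a.
                     n < m \<and> (\<forall>i\<le>n. a i \<in> {1..k})})"

(* In words with several variables, Letter a stands for the letter a and Var i for x_i. *)

datatype symb = Letter nat | Var nat

definition multi_variable_word :: "nat \<Rightarrow> nat \<Rightarrow> symb list \<Rightarrow> bool" where
  "multi_variable_word k m w \<longleftrightarrow>
     set w \<subseteq> Letter ` {1..k} \<union> Var ` {..<m} \<and>
     (\<forall>i<m. Var i \<in> set w) \<and>
     (\<forall>i j p q. i < j \<and> p < length w \<and> q < length w \<and> w ! p = Var i \<and> w ! q = Var j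
        \<longrightarrow> p < q)"

definition subst_vars :: "symb list \<Rightarrow> (nat \<Rightarrow> nat) \<Rightarrow> nat list" where
  "subst_vars w a = map (\<lambda>c. case c of Letter b \<Rightarrow> b | Var i \<Rightarrow> a i) w"

definition combinatorial_subspace :: "nat \<Rightarrow> nat \<Rightarrow> nat \<Rightarrow> nat list set \<Rightarrow> bool" where
  "combinatorial_subspace k m N V \<longleftrightarrow>
     (\<exists>w. multi_variable_word k m w \<and> length w = N \<and>
        V = {subst_vars w a | a. \<forall>i<m. a i \<in> {1..k}})"

end

theory Submission
  imports Defs
begin

text \<open>
  Apply property (P) to the tree of all words of length at most \<open>N\<close>, with the event at \<open>t\<close> being
  the event \<open>A\<close> at \<open>t\<close> padded with the letter \<open>1\<close> up to length \<open>N\<close>. The top level of the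
  resulting tree \<open>S\<close> consists of words of one common length, so padding is injective on it and
  turns it into an \<open>m\<close>-dimensional combinatorial subspace of \<open>[k]\<^sup>N\<close>.
\<close>

text \<open>For \<open>a\<close> with values in \<open>{1..k}\<close> these are the words at the top
  level of the \<open>m\<close>-dimensional tree given by \<open>w\<close> and \<open>W\<close>,
  that is, the case \<open>n = m - 1\<close> of its definition.\<close>

definition branch :: "nat list \<Rightarrow> (nat \<Rightarrow> nat option list) \<Rightarrow> nat \<Rightarrow> (nat \<Rightarrow> nat) \<Rightarrow> nat list" where
  "branch w W m a = w @ concat (map (\<lambda>i. subst_x (W i) (a i)) [0..<m])"

definition pad :: "nat \<Rightarrow> nat list \<Rightarrow> nat list" where
  "pad N t = t @ replicate (N - length t) 1"

definition lift_word :: "nat \<Rightarrow> nat option list \<Rightarrow> symb list" where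
  "lift_word i = map (\<lambda>c. case c of None \<Rightarrow> Var i | Some b \<Rightarrow> Letter b)"

text \<open>The single variable of the block \<open>W i\<close> is renamed to \<open>Var i\<close>,
  so that one word parametrizes the whole top level; \<open>r\<close> is the number of padding
  letters.\<close>

definition branch_word :: "nat list \<Rightarrow> (nat \<Rightarrow> nat option list) \<Rightarrow> nat \<Rightarrow> nat \<Rightarrow> symb list" where
  "branch_word w W m r =
     map Letter w @ concat (map (\<lambda>i. lift_word i (W i)) [0..<m]) @ replicate r (Letter 1)"

lemma length_branch: "length (branch w W m a) = length w + (\<Sum>i<m. length (W i))"
  by (simp add: branch_def length_concat subst_x_def comp_def interv_sum_list_conv_sum_set_nat
      atLeast0LessThan)

lemma length_branch_word:
  "length (branch_word w W m r) = length w + (\<Sum>i<m. length (W i)) + r"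
  by (simp add: branch_word_def length_concat lift_word_def comp_def
      interv_sum_list_conv_sum_set_nat atLeast0LessThan)

text \<open>Words of equal length receive equally long padding, which can be cancelled. For mixed
  lengths this fails: \<open>[]\<close> and \<open>[1]\<close> have the same image under
  \<open>pad 1\<close>.\<close>

lemma inj_on_pad: "\<forall>t\<in>B. length t = L \<Longrightarrow> inj_on (pad N) B"
  by (auto simp: inj_on_def pad_def)

lemma subst_vars_branch_word:
  "subst_vars (branch_word w W m r) a = branch w W m a @ replicate r 1"
  by (auto simp: subst_vars_def branch_word_def branch_def lift_word_def subst_x_def map_concat
      comp_def intro!: arg_cong[of _ _ concat] split: option.split)

lemma Var_in_lift_word: "Var j \<in> set (lift_word i u) \<longleftrightarrow> j = i \<and> None \<in> set u"
  by (force simp: lift_word_def image_iff split: option.splits)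

text \<open>\<open>Var i\<close> occurs because a left variable word begins with its variable, and
  the variables are ordered because \<open>Var i\<close> occurs in the block \<open>i\<close> only.
  The bound on \<open>k\<close> makes the padding letter \<open>1\<close> admissible.\<close>

lemma multi_variable_branch_word:
  assumes "w \<in> words k" and W: "\<forall>i<m. left_variable_word k (W i)" and "k \<ge> 1"
  shows "multi_variable_word k m (branch_word w W m r)"
  unfolding multi_variable_word_def
proof (intro conjI allI impI)
  show "set (branch_word w W m r) \<subseteq> Letter ` {1..k} \<union> Var ` {..<m}"
  proof -
    have "set (lift_word i (W i)) \<subseteq> Letter ` {1..k} \<union> Var ` {..<m}" if "i < m" for i
      using W that by (fastforce simp: left_variable_word_def lift_word_def split: option.splits)
    moreover have "set (branch_word w W m r) \<subseteq>
        Letter ` insert 1 (set w) \<union> (\<Union>i<m. set (lift_word i (W i)))"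
      by (auto simp: branch_word_def)
    moreover have "insert 1 (set w) \<subseteq> {1..k}"
      using assms by (auto simp: words_def)
    ultimately show ?thesis by blast
  qed
next
  fix i assume "i < m"
  then have "None \<in> set (W i)"
    using W by (metis left_variable_word_def list.set_sel(1))
  with \<open>i < m\<close> show "Var i \<in> set (branch_word w W m r)"
    by (auto simp: branch_word_def Var_in_lift_word)
next
  fix i j p q
  let ?v = "branch_word w W m r"
  assume *: "i < j \<and> p < length ?v \<and> q < length ?v \<and> ?v ! p = Var i \<and> ?v ! q = Var j"
  \<comment> \<open>The ordering condition ranges over all indices; an occurrence of
    \<open>Var j\<close> forces \<open>j < m\<close>, so there is a block \<open>j\<close> to cut
    at.\<close>
  then have "Var j \<in> set ?v" by (metis nth_mem)
  then have "j < m" by (auto simp: branch_word_def Var_in_lift_word)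
  then have upt: "[0..<m] = [0..<j] @ [j..<m]"
    using upt_add_eq_append[of 0 j "m - j"] by simp
  \<comment> \<open>Cutting just before block \<open>j\<close> separates the variables:
    \<open>Var j\<close> cannot occur in \<open>ys\<close>, nor \<open>Var i\<close> with
    \<open>i < j\<close> in \<open>zs\<close>. Hence \<open>p\<close> lies in \<open>ys\<close> and
    \<open>q\<close> in \<open>zs\<close>.\<close>
  define ys where "ys = map Letter w @ concat (map (\<lambda>i. lift_word i (W i)) [0..<j])"
  define zs where
    "zs = concat (map (\<lambda>i. lift_word i (W i)) [j..<m]) @ replicate r (Letter 1)"
  have v: "?v = ys @ zs"
    by (simp add: branch_word_def ys_def zs_def upt)
  have "Var i \<notin> set zs" "Var j \<notin> set ys"
    using * by (auto simp: zs_def ys_def Var_in_lift_word)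
  have "p < length ys"
  proof (rule ccontr)
    assume "\<not> p < length ys"
    then have "Var i = zs ! (p - length ys)" "p - length ys < length zs"
      using * by (auto simp: v nth_append)
    with \<open>Var i \<notin> set zs\<close> show False by (metis nth_mem)
  qed
  moreover have "\<not> q < length ys"
    using * \<open>Var j \<notin> set ys\<close> by (metis nth_append nth_mem v)
  ultimately show "p < q" by simp
qed

text \<open>The length of a branch does not depend on \<open>a\<close>, so every branch is padded by
  the same number \<open>r\<close> of letters, and all padded branches are instances of one variable
  word.\<close>

lemma combinatorial_subspace_pad_branch:
  assumes "w \<in> words k" and "\<forall>i<m. left_variable_word k (W i)" and "k \<ge> 1"
    and "length w + (\<Sum>i<m. length (W i)) \<le> N"
  shows "combinatorial_subspace k m N (pad N ` {branch w W m a | a. \<forall>i<m. a i \<in> {1..k}})"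
proof -
  define r where "r = N - (length w + (\<Sum>i<m. length (W i)))"
  have "pad N (branch w W m a) = subst_vars (branch_word w W m r) a" for a
    by (simp add: pad_def subst_vars_branch_word length_branch r_def)
  then have "pad N ` {branch w W m a | a. \<forall>i<m. a i \<in> {1..k}} =
      {subst_vars (branch_word w W m r) a | a. \<forall>i<m. a i \<in> {1..k}}"
    by (auto simp: setcompr_eq_image image_image)
  moreover have "length (branch_word w W m r) = N"
    using assms(4) by (simp add: length_branch_word r_def)
  ultimately show ?thesis
    using multi_variable_branch_word[OF assms(1-3), of r]
    unfolding combinatorial_subspace_def by blast
qed

lemma carlson_simpson_tree_contains_top:
  assumes "carlson_simpson_tree k m S"
  obtains w W where "w \<in> words k" and "\<forall>i<m. left_variable_word k (W i)"
    and "{branch w W m a | a. \<forall>i<m. a i \<in> {1..k}} \<subseteq> S"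
proof -
  from assms obtain w W where "m \<ge> 1" "w \<in> words k" "\<forall>i<m. left_variable_word k (W i)"
    and S: "S = {w} \<union> {w @ concat (map (\<lambda>i. subst_x (W i) (a i)) [0..<Suc n]) | n a.
                     n < m \<and> (\<forall>i\<le>n. a i \<in> {1..k})}"
    unfolding carlson_simpson_tree_def by blast
  have "branch w W m a \<in> S" if "\<forall>i<m. a i \<in> {1..k}" for a
  proof -
    \<comment> \<open>The definition of a tree uses \<open>Suc n\<close> blocks;
      \<open>m \<ge> 1\<close> allows \<open>n = m - 1\<close>.\<close>
    have "branch w W m a = w @ concat (map (\<lambda>i. subst_x (W i) (a i)) [0..<Suc (m - 1)])"
      using \<open>m \<ge> 1\<close> by (simp add: branch_def)
    moreover have "m - 1 < m" "\<forall>i\<le>m - 1. a i \<in> {1..k}"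
      using \<open>m \<ge> 1\<close> that by auto
    ultimately show ?thesis unfolding S by blast
  qed
  with that \<open>w \<in> words k\<close> \<open>\<forall>i<m. left_variable_word k (W i)\<close> show ?thesis by blast
qed

text \<open>The root is the empty word and every left variable word is the bare variable, so each
  level adds one free letter.\<close>

lemma carlson_simpson_tree_bounded_words:
  assumes "N \<ge> 1"
  obtains T where "carlson_simpson_tree k N T" and "T \<subseteq> {t \<in> words k. length t \<le> N}"
proof
  let ?W = "\<lambda>_::nat. [None :: nat option]"
  let ?T = "{[]} \<union> {[] @ concat (map (\<lambda>i. subst_x (?W i) (a i)) [0..<Suc n]) | n a.
                     n < N \<and> (\<forall>i\<le>n. a i \<in> {1..k})}"
  have "[] \<in> words k" "\<forall>i<N. left_variable_word k (?W i)"
    by (auto simp: words_def left_variable_word_def)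
  then show "carlson_simpson_tree k N ?T"
    unfolding carlson_simpson_tree_def using assms
    by (intro conjI exI[of _ "[]"] exI[of _ ?W] refl)
  have "concat (map (\<lambda>i. subst_x (?W i) (a i)) [0..<Suc n]) = map a [0..<Suc n]"
    for a :: "nat \<Rightarrow> nat" and n
    by (simp add: subst_x_def)
  then show "?T \<subseteq> {t \<in> words k. length t \<le> N}"
    by (auto simp: words_def simp del: upt_Suc)
qed

theorem corollary1p3:
  fixes \<theta> :: "nat \<Rightarrow> real \<Rightarrow> nat \<Rightarrow> real"
    and Cor :: "nat \<Rightarrow> real \<Rightarrow> nat \<Rightarrow> int"
    and k m N :: nat
    and \<epsilon> :: real
    and M :: "'a measure"
    and A :: "nat list \<Rightarrow> 'a set"
  assumes theta_pos:
      "\<And>k \<epsilon> n. k \<ge> 2 \<Longrightarrow> n \<ge> 1 \<Longrightarrow> 0 < \<epsilon> \<Longrightarrow> \<epsilon> \<le> 1 \<Longrightarrow> \<theta> k \<epsilon> n > 0"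
    and property_P:
      "\<And>k m d \<epsilon> T (M :: 'a measure) A.
         k \<ge> 2 \<Longrightarrow> m \<ge> 1 \<Longrightarrow> 0 < \<epsilon> \<Longrightarrow> \<epsilon> \<le> 1 \<Longrightarrow>
         carlson_simpson_tree k d T \<Longrightarrow> int d \<ge> Cor k \<epsilon> m \<Longrightarrow>
         prob_space M \<Longrightarrow> (\<forall>t\<in>T. A t \<in> sets M \<and> measure M (A t) \<ge> \<epsilon>) \<Longrightarrow>
         \<exists>S. S \<subseteq> T \<and> carlson_simpson_tree k m S \<and>
             (\<forall>F. F \<subseteq> S \<and> F \<noteq> {} \<longrightarrow> measure M (\<Inter>t\<in>F. A t) \<ge> \<theta> k \<epsilon> (card F))"
    and "k \<ge> 2" and "m \<ge> 1" and "0 < \<epsilon>" and "\<epsilon> \<le> 1"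
    and "N \<ge> 1" and "int N \<ge> Cor k \<epsilon> m"
    and "prob_space M"
    and "\<forall>w\<in>words_of_length k N. A w \<in> sets M \<and> measure M (A w) \<ge> \<epsilon>"
  shows "\<exists>V. combinatorial_subspace k m N V \<and>
           (\<forall>n\<in>{1..card V}. \<forall>F. F \<subseteq> V \<and> card F = n \<longrightarrow>
              measure M (\<Inter>w\<in>F. A w) \<ge> \<theta> k \<epsilon> n)"
proof -
  define L where "L = {t \<in> words k. length t \<le> N}"
  obtain T where T: "carlson_simpson_tree k N T" "T \<subseteq> L"
    using carlson_simpson_tree_bounded_words[OF \<open>N \<ge> 1\<close>] unfolding L_def by blast
  have "pad N t \<in> words_of_length k N" if "t \<in> T" for t
    using that T(2) \<open>k \<ge> 2\<close> by (auto simp: L_def pad_def words_of_length_def words_def)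
  then have ev: "\<forall>t\<in>T. A (pad N t) \<in> sets M \<and> measure M (A (pad N t)) \<ge> \<epsilon>"
    using assms(10) by blast
  obtain S where S: "S \<subseteq> T" "carlson_simpson_tree k m S"
    and bound: "\<And>F. F \<subseteq> S \<Longrightarrow> F \<noteq> {} \<Longrightarrow> measure M (\<Inter>t\<in>F. A (pad N t)) \<ge> \<theta> k \<epsilon> (card F)"
    using property_P[OF \<open>k \<ge> 2\<close> \<open>m \<ge> 1\<close> \<open>0 < \<epsilon>\<close> \<open>\<epsilon> \<le> 1\<close> T(1) \<open>int N \<ge> Cor k \<epsilon> m\<close>
        \<open>prob_space M\<close> ev] by blast
  obtain w W where w: "w \<in> words k" "\<forall>i<m. left_variable_word k (W i)"
    and top: "{branch w W m a | a. \<forall>i<m. a i \<in> {1..k}} \<subseteq> S"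
    using carlson_simpson_tree_contains_top[OF S(2)] .
  define B where "B = {branch w W m a | a. \<forall>i<m. a i \<in> {1..k}}"
  \<comment> \<open>Since all branches have the same length, a single one lying in \<open>S\<close>
    shows that this length is at most \<open>N\<close>.\<close>
  have "branch w W m (\<lambda>_. 1) \<in> S"
    using top \<open>k \<ge> 2\<close> by fastforce
  then have "length w + (\<Sum>i<m. length (W i)) \<le> N"
    using S(1) T(2) length_branch[of w W m "\<lambda>_. 1"] by (auto simp: L_def)
  then have V: "combinatorial_subspace k m N (pad N ` B)"
    unfolding B_def using combinatorial_subspace_pad_branch w \<open>k \<ge> 2\<close> by simp
  \<comment> \<open>Property (P) gives a bound in terms of the number of tree nodes; injectivity
    makes this the number of words in the subspace.\<close>
  have inj: "inj_on (pad N) B"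
    by (rule inj_on_pad) (auto simp: B_def length_branch)
  have "measure M (\<Inter>w\<in>F. A w) \<ge> \<theta> k \<epsilon> n"
    if n: "n \<in> {1..card (pad N ` B)}" and F: "F \<subseteq> pad N ` B" "card F = n" for n F
  proof -
    \<comment> \<open>\<open>F\<close> is pulled back to a set \<open>G\<close> of nodes of
      \<open>S\<close> with the same cardinality and the same intersection of events, to which
      \<open>bound\<close> applies.\<close>
    obtain G where G: "G \<subseteq> B" "F = pad N ` G"
      using F(1) by (auto simp: subset_image_iff)
    then have "card G = n"
      using F(2) inj by (metis card_image inj_on_subset)
    moreover from this n have "G \<noteq> {}" by auto
    ultimately show ?thesis
      using bound[of G] G top by (auto simp: B_def)
  qed
  with V show ?thesis by blast
qed

end
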